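(* Let $d=2$, let $M$ and $Q_1,Q_2$ be a.s. positive, assume that (A1)--(A6) (listed in the context) hold for $i=1,2$, and that $c_2/c_1>b_2/b_1\ge1$ and $c_1>0$ (with the convention $0/0=1$). Let $$X_i=\sum_{k=1}^\infty\Big(\prod_{l=1}^{k-1}(b_i+c_iM_l)\Big)Q_{k,i},\qquad i=1,2.$$ Then $$\lim_{u\to\infty}u\,\mathbb P\big(X_2>u^{1/\alpha_2},\;X_1>u^{1/\alpha_1}\big)=0,$$ i.e. $X_1$ and $X_2$ are asymptotically independent.
   Context: Setting: $b_i,c_i\ge 0$ are constants, $(M_t)$ are iid real random variables, $(\boldsymbol Q_t)=((Q_{t,1},Q_{t,2}))$ are iid $\mathbb R^2$-valued random vectors independent of $(M_t)$, and $(M,\boldsymbol Q)$ with $\boldsymbol Q=(Q_1,Q_2)$ is a generic copy of $(M_t,\boldsymbol Q_t)$. Assumptions: (A1) $\mathbb E[\log|b_i+c_iM|]<0$. (A2) There is $\alpha_i>0$ with $\mathbb E[|b_i+c_iM|^{\alpha_i}]=1$. (A3) $\mathbb E[|M|^{\alpha_i+\epsilon}]<\infty$ and $\mathbb E[\|\boldsymbol Q\|^{\alpha_i+\epsilon}]<\infty$ for some $\epsilon>0$ ($\|\cdot\|$ the max-norm). (A4) The distribution of $\log|b_i+c_iM|$ is non-arithmetic. (A5) $\mathbb P((b_i+c_iM)x+Q_i=x)<1$ for all $x\in\mathbb R$, and $\mathbb P(Q_i>0)>0$. (A6) For all pairs $i,j$ with $\alpha_i>\alpha_j$: $\lim_{u\to\infty}\log(u)\,\mathbb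 P(|Q_j|/|Q_i|>u^{\varepsilon})=0$ for all $\varepsilon>0$. *)

theory Defs
  imports "HOL-Probability.Probability"
begin

text \<open>
  Expectation with values in \<open>[-\<infinity>, \<infinity>]\<close>, so that
  \<open>ext_expectation P X < 0\<close> allows the value \<open>-\<infinity>\<close> (a Bochner integral would be 0 there).
  If both parts have infinite integral, the value is \<open>\<infinity> - \<infinity> = \<infinity>\<close>, hence never negative.
\<close>
definition ext_expectation :: "'a measure \<Rightarrow> ('a \<Rightarrow> real) \<Rightarrow> ereal" where
  "ext_expectation P X =
     enn2ereal (\<integral>\<^sup>+ \<omega>. ennreal (X \<omega>) \<partial>P) - enn2ereal (\<integral>\<^sup>+ \<omega>. ennreal (- X \<omega>) \<partial>P)"

text \<open>Not concentrated on any lattice \<open>h \<int>\<close> through the origin.\<close>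
definition nonarithmetic :: "real measure \<Rightarrow> bool" where
  "nonarithmetic \<mu> \<longleftrightarrow> \<not> (\<exists>h>0. AE x in \<mu>. \<exists>k::int. x = h * of_int k)"

text \<open>
  Ratio of nonnegative reals with \<open>0 / 0 = 1\<close>; for \<open>x > 0\<close> the extended-real quotient
  gives \<open>x / 0 = \<infinity>\<close>.
\<close>
definition ratio :: "real \<Rightarrow> real \<Rightarrow> ereal" where
  "ratio x y = (if x = 0 \<and> y = 0 then 1 else ereal x / ereal y)"

text \<open>
  The innovations carry the time indices \<open>t \<ge> 1\<close>; the values of \<open>Ms\<close> and \<open>Qs\<close> at 0 are
  irrelevant. \<open>(M, Q)\<close> is the generic copy. The two sequences have different value types, which
  \<open>indep_var\<close> does not permit, so their independence is that of the sigma-algebras they generate.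
\<close>
definition iid_innovations ::
  "'a measure \<Rightarrow> (nat \<Rightarrow> 'a \<Rightarrow> real) \<Rightarrow> (nat \<Rightarrow> 'a \<Rightarrow> real ^ 2) \<Rightarrow>
   ('a \<Rightarrow> real) \<Rightarrow> ('a \<Rightarrow> real ^ 2) \<Rightarrow> bool" where
  "iid_innovations P Ms Qs M Q \<longleftrightarrow>
     M \<in> borel_measurable P \<and> Q \<in> borel_measurable P \<and>
     prob_space.indep_vars P (\<lambda>_. borel) Ms {1..} \<and>
     prob_space.indep_vars P (\<lambda>_. borel) Qs {1..} \<and>
     prob_space.indep_set P
       (sets (vimage_algebra (space P) (\<lambda>\<omega>. \<lambda>t\<in>{1..}. Ms t \<omega>) (\<Pi>\<^sub>M t\<in>{1..}. borel)))
       (sets (vimage_algebra (space P) (\<lambda>\<omega>. \<lambda>t\<in>{1..}. Qs t \<omega>) (\<Pi>\<^sub>M t\<in>{1..}. borel))) \<and>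
     (\<forall>t\<ge>1. distr P (borel \<Otimes>\<^sub>M borel) (\<lambda>\<omega>. (Ms t \<omega>, Qs t \<omega>)) =
             distr P (borel \<Otimes>\<^sub>M borel) (\<lambda>\<omega>. (M \<omega>, Q \<omega>)))"

text \<open>The summand with index \<open>n\<close> is the one usually indexed by \<open>k = n + 1\<close>.\<close>
definition perpetuity ::
  "real ^ 2 \<Rightarrow> real ^ 2 \<Rightarrow> (nat \<Rightarrow> 'a \<Rightarrow> real) \<Rightarrow> (nat \<Rightarrow> 'a \<Rightarrow> real ^ 2) \<Rightarrow> 2 \<Rightarrow> 'a \<Rightarrow> real" where
  "perpetuity b c Ms Qs i \<omega> =
     (\<Sum>n. (\<Prod>l=1..n. b $ i + c $ i * Ms l \<omega>) * (Qs (Suc n) \<omega> $ i))"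

end

theory Submission
  imports Defs
begin

text \<open>
  Write \<open>A\<^sub>i = b\<^sub>i + c\<^sub>i M\<close> and \<open>U\<^sub>i = A\<^sub>i powr \<alpha>\<^sub>i\<close>, so that \<open>E U\<^sub>i = 1\<close>. Since \<open>0 < A\<^sub>1 < A\<^sub>2\<close> almost surely,
  \<open>U\<^sub>1\<close> and \<open>U\<^sub>2\<close> do not agree almost surely, and neither is almost surely 1 because
  \<open>E log A\<^sub>i < 0\<close>. The equality case of the inequality between arithmetic and geometric mean
  makes \<open>E (U\<^sub>1 U\<^sub>2) powr p\<close>, \<open>E U\<^sub>1 powr p\<close> and \<open>E U\<^sub>2 powr p\<close> strictly less than 1 at \<open>p = 1/2\<close>,
  hence also at some \<open>p > 1/2\<close>. With \<open>s = p \<alpha>\<^sub>2\<close> and \<open>t = p \<alpha>\<^sub>1\<close>, the joint \<open>(s, t)\<close>-moment of the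
  \<open>n\<close>-th term of \<open>X\<^sub>2\<close> and the \<open>m\<close>-th term of \<open>X\<^sub>1\<close> is then at most \<open>K q ^ max n m\<close> for some \<open>q < 1\<close>.
  Markov's inequality, with geometric weights to separate the terms of the two series, bounds the
  joint tail probability by \<open>C u powr (- 2 p)\<close>, which is \<open>o(1 / u)\<close>.
\<close>

section \<open>Product formula from independence of generated sigma-algebras\<close>

text \<open>\<open>X\<close> and \<open>Y\<close> may have different value types, so
  \<open>indep_var\<close> does not apply to them. It does apply to \<open>f \<circ> X\<close> and
  \<open>g \<circ> Y\<close>, which both take values in \<open>ennreal\<close> and generate smaller
  sigma-algebras than \<open>X\<close> and \<open>Y\<close>.\<close>

lemma (in prob_space) nn_integral_mult_indep:
  fixes f :: "'b \<Rightarrow> ennreal" and g :: "'c \<Rightarrow> ennreal"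
  assumes X [measurable]: "random_variable S X" and Y [measurable]: "random_variable T Y"
    and ind: "indep_set (sets (vimage_algebra (space M) X S)) (sets (vimage_algebra (space M) Y T))"
    and f [measurable]: "f \<in> borel_measurable S" and g [measurable]: "g \<in> borel_measurable T"
  shows "(\<integral>\<^sup>+\<omega>. f (X \<omega>) * g (Y \<omega>) \<partial>M) = (\<integral>\<^sup>+\<omega>. f (X \<omega>) \<partial>M) * (\<integral>\<^sup>+\<omega>. g (Y \<omega>) \<partial>M)"
proof -
  have sub: "sigma_sets (space M) {(h \<circ> Z) -` A \<inter> space M |A. A \<in> sets borel} \<subseteq> sets (vimage_algebra (space M) Z N)"
    if [measurable]: "h \<in> borel_measurable N" and Z: "random_variable N Z"
    for h :: "'d \<Rightarrow> ennreal" and Z :: "'a \<Rightarrow> 'd" and N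
  proof -
    have "{(h \<circ> Z) -` A \<inter> space M |A. A \<in> sets borel} \<subseteq> {Z -` B \<inter> space M |B. B \<in> sets N}"
    proof safe
      fix A :: "ennreal set" assume [measurable]: "A \<in> sets borel"
      have "(h \<circ> Z) -` A \<inter> space M = Z -` (h -` A \<inter> space N) \<inter> space M"
        using measurable_space[OF Z] by auto
      moreover have "h -` A \<inter> space N \<in> sets N" by measurable
      ultimately show "\<exists>B. (h \<circ> Z) -` A \<inter> space M = Z -` B \<inter> space M \<and> B \<in> sets N" by blast
    qed
    then show ?thesis unfolding sets_vimage_algebra by (rule sigma_sets_mono')
  qed
  have "indep_set (sigma_sets (space M) {(f \<circ> X) -` A \<inter> space M |A. A \<in> sets borel})
      (sigma_sets (space M) {(g \<circ> Y) -` A \<inter> space M |A. A \<in> sets borel})"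
    using ind sub[OF f X] sub[OF g Y] unfolding indep_sets2_eq by blast
  then have "indep_var borel (f \<circ> X) borel (g \<circ> Y)"
    unfolding indep_var_eq by (auto intro: measurable_comp[OF X f] measurable_comp[OF Y g])
  \<comment> \<open>The pair is recast as a family over \<open>bool\<close>, to which the product
    formula for independent families applies.\<close>
  then have "indep_vars (\<lambda>_. borel) (case_bool (f \<circ> X) (g \<circ> Y)) UNIV"
    unfolding indep_var_def by (metis (full_types) bool.case_eq_if indep_vars_cong)
  from indep_vars_nn_integral[OF _ this] show ?thesis
    by (simp add: UNIV_bool comp_def mult.commute)
qed

section \<open>Joint tails of two random series\<close>

text \<open>
  As the bound forces summability, the contrapositive also covers divergent series, where
  \<open>suminf\<close> is an unspecified value.
\<close>
lemma suminf_le_geometric: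
  fixes x :: "nat \<Rightarrow> real"
  assumes "0 \<le> \<rho>" "\<rho> < 1" and le: "\<And>n. \<bar>x n\<bar> \<le> v * (1 - \<rho>) * \<rho> ^ n"
  shows "suminf x \<le> v"
proof -
  have "(\<lambda>n. v * (1 - \<rho>) * \<rho> ^ n) sums (v * (1 - \<rho>) * (1 / (1 - \<rho>)))"
    using assms by (intro sums_mult geometric_sums) auto
  then have g: "(\<lambda>n. v * (1 - \<rho>) * \<rho> ^ n) sums v"
    using assms by simp
  then have "summable x"
    using le by (intro summable_comparison_test[of x "\<lambda>n. v * (1 - \<rho>) * \<rho> ^ n"]) (auto simp: sums_iff)
  then have "suminf x \<le> (\<Sum>n. v * (1 - \<rho>) * \<rho> ^ n)"
    using le g by (intro suminf_le) (auto simp: sums_iff abs_le_iff)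
  with g show ?thesis by (simp add: sums_iff)
qed

text \<open>If a series exceeds \<open>v\<close>, some term exceeds its share
  \<open>v * (1 - \<rho>) * \<rho> ^ n\<close> in absolute value. A union bound over pairs of terms
  and Markov's inequality then reduce the joint tail to the mixed moments in \<open>mom\<close>. The
  constant \<open>C\<close> depends on neither \<open>v\<close> nor \<open>w\<close>.\<close>

lemma (in prob_space) prob_two_suminf_gt_le:
  fixes x y :: "nat \<Rightarrow> 'a \<Rightarrow> real"
  assumes [measurable]: "\<And>n. x n \<in> borel_measurable M" "\<And>n. y n \<in> borel_measurable M"
    and s: "s > 0" and t: "t > 0" and z: "0 < z" "z < 1" and K: "K \<ge> 0"
    and mom: "\<And>n m. (\<integral>\<^sup>+\<omega>. ennreal (\<bar>x n \<omega>\<bar> powr s * \<bar>y m \<omega>\<bar> powr t) \<partial>M) \<le> ennreal (K * z ^ n * z ^ m)"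
  obtains C where "\<And>v w. v > 0 \<Longrightarrow> w > 0 \<Longrightarrow>
      prob {\<omega> \<in> space M. (\<Sum>n. x n \<omega>) > v \<and> (\<Sum>n. y n \<omega>) > w} \<le> C * v powr - s * w powr - t"
proof
  \<comment> \<open>The weights must decay slowly compared with the moments: this \<rho> satisfies
    \<open>\<rho> powr - e \<le> z powr - (1 / 2)\<close> for all positive
    \<open>e \<le> s + t\<close>, in particular for \<open>s\<close> and \<open>t\<close>. Dividing
    by the weights thus costs at most a factor \<open>sqrt z\<close> per index, and the geometric
    ratio \<open>r = sqrt z\<close> is left.\<close>
  define \<rho> where "\<rho> = z powr (1 / (2 * (s + t)))"
  have \<rho>: "0 < \<rho>" "\<rho> < 1"
    using z s t powr_less_mono2[of "1 / (2 * (s + t))" z 1] by (auto simp: \<rho>_def)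
  define r where "r = sqrt z"
  have r: "0 < r" "r < 1" "r * r = z" using z by (auto simp: r_def)
  define D where "D = (1 - \<rho>) powr - s * (1 - \<rho>) powr - t * K"
  have D: "D \<ge> 0" using K by (simp add: D_def)
  have \<rho>r: "(\<rho> ^ n) powr - e * z ^ n \<le> r ^ n" if e: "0 < e" "e \<le> s + t" for n e
  proof -
    have "\<rho> powr - e = z powr - (e / (2 * (s + t)))"
      by (simp add: \<rho>_def powr_powr)
    also have "\<dots> \<le> z powr - (1 / 2)"
      using e z s t by (intro powr_mono') (auto simp: field_simps)
    also have "\<dots> = 1 / r"
      using z by (simp add: r_def powr_minus powr_half_sqrt field_simps)
    finally have "\<rho> powr - e * z \<le> 1 / r * z"
      using z by (intro mult_right_mono) auto
    also have "\<dots> = r" using r by (simp add: field_simps)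
    finally have "(\<rho> powr - e * z) ^ n \<le> r ^ n"
      using z by (intro power_mono) auto
    moreover have "(\<rho> ^ n) powr - e = (\<rho> powr - e) ^ n"
      using \<rho> by (simp add: powr_realpow[symmetric] powr_powr mult.commute)
    ultimately show ?thesis by (simp add: power_mult_distrib)
  qed
  fix v w :: real assume v: "v > 0" and w: "w > 0"
  let ?E = "{\<omega> \<in> space M. (\<Sum>n. x n \<omega>) > v \<and> (\<Sum>n. y n \<omega>) > w}"
  define a where "a n = v * (1 - \<rho>) * \<rho> ^ n" for n
  define d where "d n = w * (1 - \<rho>) * \<rho> ^ n" for n
  have a: "a n > 0" and d: "d n > 0" for n
    using v w \<rho> by (auto simp: a_def d_def)
  \<comment> \<open>The Markov quotient of the pair (n, m). On the event some pair has both terms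
    above their thresholds, so that its quotient, and hence the double sum, is at least 1.\<close>
  define F where "F n m \<omega> = ennreal (\<bar>x n \<omega>\<bar> powr s * \<bar>y m \<omega>\<bar> powr t * (a n powr - s * d m powr - t))"
    for n m \<omega>
  have [measurable]: "F n m \<in> borel_measurable M" for n m
    unfolding F_def by measurable
  have pt: "1 \<le> (\<Sum>n. \<Sum>m. F n m \<omega>)" if \<omega>: "\<omega> \<in> ?E" for \<omega>
  proof -
    have "\<exists>n. a n < \<bar>x n \<omega>\<bar>"
    proof (rule ccontr)
      assume "\<nexists>n. a n < \<bar>x n \<omega>\<bar>"
      then have "(\<Sum>n. x n \<omega>) \<le> v"
        using \<rho> by (intro suminf_le_geometric[of \<rho>]) (auto simp: a_def not_less)
      with \<omega> show False by simp
    qed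
    then obtain n where n: "a n < \<bar>x n \<omega>\<bar>" ..
    have "\<exists>m. d m < \<bar>y m \<omega>\<bar>"
    proof (rule ccontr)
      assume "\<nexists>m. d m < \<bar>y m \<omega>\<bar>"
      then have "(\<Sum>n. y n \<omega>) \<le> w"
        using \<rho> by (intro suminf_le_geometric[of \<rho>]) (auto simp: d_def not_less)
      with \<omega> show False by simp
    qed
    then obtain m where m: "d m < \<bar>y m \<omega>\<bar>" ..
    have "1 = (a n powr s * d m powr t) * (a n powr - s * d m powr - t)"
      using a[of n] d[of m] by (simp add: powr_minus field_simps)
    also have "\<dots> \<le> \<bar>x n \<omega>\<bar> powr s * \<bar>y m \<omega>\<bar> powr t * (a n powr - s * d m powr - t)"
      using n m a[of n] d[of m] s t
      by (intro mult_right_mono mult_mono powr_mono2) auto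
    finally have "1 \<le> F n m \<omega>"
      by (simp add: F_def flip: ennreal_1)
    also have "\<dots> \<le> (\<Sum>m. F n m \<omega>)"
      using sum_le_suminf[of "\<lambda>m. F n m \<omega>" "{m}"] by simp
    also have "\<dots> \<le> (\<Sum>n. \<Sum>m. F n m \<omega>)"
      using sum_le_suminf[of "\<lambda>n. \<Sum>m. F n m \<omega>" "{n}"] by simp
    finally show ?thesis .
  qed
  define L where "L = D * v powr - s * w powr - t"
  have L: "L \<ge> 0" using D by (simp add: L_def)
  have IF: "(\<integral>\<^sup>+\<omega>. F n m \<omega> \<partial>M) \<le> ennreal (L * r ^ n * r ^ m)" for n m
  proof -
    have "(\<integral>\<^sup>+\<omega>. F n m \<omega> \<partial>M) =
        (\<integral>\<^sup>+\<omega>. ennreal (\<bar>x n \<omega>\<bar> powr s * \<bar>y m \<omega>\<bar> powr t) \<partial>M) * ennreal (a n powr - s * d m powr - t)"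
      unfolding F_def by (subst ennreal_mult) (auto intro!: nn_integral_multc)
    also have "\<dots> \<le> ennreal (K * z ^ n * z ^ m) * ennreal (a n powr - s * d m powr - t)"
      by (intro mult_right_mono mom) auto
    also have "\<dots> = ennreal (K * z ^ n * z ^ m * (a n powr - s * d m powr - t))"
      using K z by (simp add: ennreal_mult)
    also have "K * z ^ n * z ^ m * (a n powr - s * d m powr - t) =
        L * ((\<rho> ^ n) powr - s * z ^ n) * ((\<rho> ^ m) powr - t * z ^ m)"
      using v w \<rho> by (simp add: a_def d_def L_def D_def powr_mult mult_ac)
    also have "\<dots> \<le> L * r ^ n * r ^ m"
      using s t r z L by (intro mult_mono \<rho>r) auto
    finally show ?thesis by (simp add: ennreal_leI)
  qed
  have gs: "(\<Sum>n. ennreal (c * r ^ n)) = ennreal (c * (1 / (1 - r)))" if "c \<ge> 0" for c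
    using r that by (intro suminf_ennreal_eq sums_mult geometric_sums) auto
  have "emeasure M ?E \<le> (\<integral>\<^sup>+\<omega>. (\<Sum>n. \<Sum>m. F n m \<omega>) \<partial>M)"
  \<comment> \<open>If the event were not measurable, its \<open>emeasure\<close> would be 0 by
    convention and the bound would hold trivially.\<close>
  proof (cases "?E \<in> sets M")
    case True
    then have "emeasure M ?E = (\<integral>\<^sup>+\<omega>. indicator ?E \<omega> \<partial>M)" by simp
    also have "\<dots> \<le> (\<integral>\<^sup>+\<omega>. (\<Sum>n. \<Sum>m. F n m \<omega>) \<partial>M)"
      using pt by (intro nn_integral_mono) (auto simp: indicator_def)
    finally show ?thesis .
  qed (simp add: emeasure_notin_sets)
  also have "\<dots> = (\<Sum>n. \<Sum>m. \<integral>\<^sup>+\<omega>. F n m \<omega> \<partial>M)"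
    by (simp add: nn_integral_suminf)
  also have "\<dots> \<le> (\<Sum>n. \<Sum>m. ennreal (L * r ^ n * r ^ m))"
    by (intro suminf_le IF) auto
  also have "\<dots> = (\<Sum>n. ennreal ((L * (1 / (1 - r))) * r ^ n))"
    using L r by (intro suminf_cong) (subst gs, auto simp: mult_ac)
  also have "\<dots> = ennreal (L * (1 / (1 - r)) * (1 / (1 - r)))"
    using L r by (intro gs) auto
  finally show "prob ?E \<le> D * (1 / (1 - r)) * (1 / (1 - r)) * v powr - s * w powr - t"
    using L r by (simp add: emeasure_eq_measure L_def mult_ac)
qed

section \<open>Moments of order slightly above a given one\<close>

text \<open>The arithmetic mean of \<open>U\<close> and \<open>V\<close> has expectation 1 and
  dominates the geometric mean. If the expectations agreed, the two means would agree almost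
  everywhere, and squaring would give \<open>(U \<omega> - V \<omega>)\<^sup>2 = 0\<close>.\<close>

lemma (in prob_space) expectation_sqrt_mult_less_1:
  fixes U V :: "'a \<Rightarrow> real"
  assumes U: "integrable M U" "expectation U = 1" and V: "integrable M V" "expectation V = 1"
    and nn: "\<And>\<omega>. U \<omega> \<ge> 0" "\<And>\<omega>. V \<omega> \<ge> 0" and ne: "\<not> (AE \<omega> in M. U \<omega> = V \<omega>)"
  shows "integrable M (\<lambda>\<omega>. sqrt (U \<omega> * V \<omega>))" "expectation (\<lambda>\<omega>. sqrt (U \<omega> * V \<omega>)) < 1"
proof -
  have [measurable]: "U \<in> borel_measurable M" "V \<in> borel_measurable M"
    using U V by auto
  have le: "sqrt (U \<omega> * V \<omega>) \<le> (U \<omega> + V \<omega>) / 2" for \<omega>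
    using nn by (rule arith_geo_mean_sqrt)
  have i: "integrable M (\<lambda>\<omega>. (U \<omega> + V \<omega>) / 2)" using U V by auto
  show I: "integrable M (\<lambda>\<omega>. sqrt (U \<omega> * V \<omega>))"
    by (rule Bochner_Integration.integrable_bound[OF i]) (use le nn in auto)
  have e: "expectation (\<lambda>\<omega>. (U \<omega> + V \<omega>) / 2) = 1" using U V by simp
  have "expectation (\<lambda>\<omega>. sqrt (U \<omega> * V \<omega>)) \<le> 1"
    using integral_mono[OF I i le] e by simp
  moreover have "expectation (\<lambda>\<omega>. sqrt (U \<omega> * V \<omega>)) \<noteq> 1"
  proof
    assume "expectation (\<lambda>\<omega>. sqrt (U \<omega> * V \<omega>)) = 1"
    then have "AE \<omega> in M. sqrt (U \<omega> * V \<omega>) = (U \<omega> + V \<omega>) / 2"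
      using I i e le by (intro integral_ineq_eq_0_then_AE) auto
    then have "AE \<omega> in M. U \<omega> = V \<omega>"
    proof eventually_elim
      case (elim \<omega>)
      have "U \<omega> * V \<omega> = ((U \<omega> + V \<omega>) / 2)\<^sup>2"
        using nn[of \<omega>] by (simp flip: elim)
      then have "(U \<omega> - V \<omega>)\<^sup>2 = 0" by (simp add: power2_eq_square field_simps)
      then show ?case by simp
    qed
    with ne show False by contradiction
  qed
  ultimately show "expectation (\<lambda>\<omega>. sqrt (U \<omega> * V \<omega>)) < 1" by simp
qed

text \<open>For positive \<open>w\<close> this is convexity of the exponential along
  \<open>ln w\<close>. For \<open>w = 0\<close> every power is 0, including the one with exponent
  0.\<close>

lemma powr_convex_combination:
  fixes w :: real
  assumes "w \<ge> 0" "0 \<le> l" "l \<le> 1"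
  shows "w powr ((1 - l) * a + l * b) \<le> (1 - l) * w powr a + l * w powr b"
proof (cases "w = 0")
  case False
  then have "exp ((1 - l) *\<^sub>R (a * ln w) + l *\<^sub>R (b * ln w)) \<le> (1 - l) * exp (a * ln w) + l * exp (b * ln w)"
    using assms by (intro convex_onD[OF exp_convex]) auto
  with False show ?thesis by (simp add: powr_def algebra_simps)
qed simp

text \<open>By convexity in the exponent, the moment of order \<open>p\<close> lies below the chord
  through the moments of orders \<open>a\<close> and \<open>b\<close>. The chord is continuous and
  starts below 1 at \<open>a\<close>.\<close>

lemma (in prob_space) eventually_powr_moment_less_1:
  fixes W :: "'a \<Rightarrow> real"
  assumes nn: "\<And>\<omega>. W \<omega> \<ge> 0" and [measurable]: "W \<in> borel_measurable M"
    and a: "integrable M (\<lambda>\<omega>. W \<omega> powr a)" "expectation (\<lambda>\<omega>. W \<omega> powr a) < 1"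
    and b: "a < b" "integrable M (\<lambda>\<omega>. W \<omega> powr b)"
  shows "eventually (\<lambda>p. (\<integral>\<^sup>+\<omega>. ennreal (W \<omega> powr p) \<partial>M) < 1) (at_right a)"
proof -
  let ?l = "\<lambda>p. (p - a) / (b - a)"
  let ?A = "expectation (\<lambda>\<omega>. W \<omega> powr a)" and ?B = "expectation (\<lambda>\<omega>. W \<omega> powr b)"
  have "((\<lambda>p. (1 - ?l p) * ?A + ?l p * ?B) \<longlongrightarrow> (1 - ?l a) * ?A + ?l a * ?B) (at_right a)"
    using b by (intro tendsto_intros) auto
  then have "eventually (\<lambda>p. (1 - ?l p) * ?A + ?l p * ?B < 1) (at_right a)"
    using a by (intro order_tendstoD) auto
  moreover have "eventually (\<lambda>p. p > a \<and> p < b) (at_right a)"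
    using eventually_at_right_real[OF b(1)] by eventually_elim auto
  ultimately show ?thesis
  proof eventually_elim
    case (elim p)
    define l where "l = ?l p"
    have l: "0 \<le> l" "l \<le> 1"
      using elim b by (auto simp: l_def field_simps)
    have "l * (b - a) = p - a" using b by (simp add: l_def)
    then have p: "p = (1 - l) * a + l * b" by (simp add: algebra_simps)
    have I: "integrable M (\<lambda>\<omega>. (1 - l) * W \<omega> powr a + l * W \<omega> powr b)"
      using a b by auto
    have "(\<integral>\<^sup>+\<omega>. ennreal (W \<omega> powr p) \<partial>M) \<le> (\<integral>\<^sup>+\<omega>. ennreal ((1 - l) * W \<omega> powr a + l * W \<omega> powr b) \<partial>M)"
      unfolding p by (intro nn_integral_mono ennreal_leI powr_convex_combination nn l)
    also have "\<dots> = ennreal ((1 - l) * ?A + l * ?B)"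
      using l a b by (subst nn_integral_eq_integral[OF I]) auto
    also have "\<dots> < 1"
      using elim unfolding l_def by (simp only: ennreal_less_one_iff)
    finally show ?case .
  qed
qed

text \<open>The order is raised by \<open>\<bar>X \<omega>\<bar> powr a \<le> 1 + \<bar>X
  \<omega>\<bar> powr b\<close>; then \<open>K + L * Y \<omega>\<close> is at most twice its larger
  summand, which avoids any convexity requirement on \<open>b\<close>.\<close>

lemma (in prob_space) integrable_powr_le:
  fixes X :: "'a \<Rightarrow> real"
  assumes [measurable]: "X \<in> borel_measurable M"
    and le: "\<And>\<omega>. \<bar>X \<omega>\<bar> \<le> K + L * Y \<omega>" and Y: "\<And>\<omega>. Y \<omega> \<ge> 0" "integrable M (\<lambda>\<omega>. Y \<omega> powr b)"
    and K: "K \<ge> 0" and L: "L \<ge> 0" and a: "0 \<le> a" "a \<le> b"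
  shows "integrable M (\<lambda>\<omega>. \<bar>X \<omega>\<bar> powr a)"
proof (rule Bochner_Integration.integrable_bound)
  show "integrable M (\<lambda>\<omega>. 1 + ((2 * K) powr b + (2 * L) powr b * Y \<omega> powr b))"
    using Y by auto
  have "\<bar>X \<omega>\<bar> powr a \<le> 1 + ((2 * K) powr b + (2 * L) powr b * Y \<omega> powr b)" for \<omega>
  proof -
    have "\<bar>X \<omega>\<bar> powr a \<le> 1 + \<bar>X \<omega>\<bar> powr b"
    proof (cases "\<bar>X \<omega>\<bar> \<le> 1")
      case True
      then have "\<bar>X \<omega>\<bar> powr a \<le> 1 powr a" using a by (intro powr_mono2) auto
      then show ?thesis by (simp add: add_increasing2)
    next
      case False
      then have "\<bar>X \<omega>\<bar> powr a \<le> \<bar>X \<omega>\<bar> powr b" using a by (intro powr_mono) auto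
      then show ?thesis by simp
    qed
    moreover have "\<bar>X \<omega>\<bar> powr b \<le> (2 * K) powr b + (2 * L) powr b * Y \<omega> powr b"
    proof (cases "K \<le> L * Y \<omega>")
      case True
      then have "\<bar>X \<omega>\<bar> powr b \<le> (2 * L * Y \<omega>) powr b"
        using le[of \<omega>] a by (intro powr_mono2) auto
      then show ?thesis using L Y by (simp add: powr_mult add_increasing)
    next
      case False
      then have "\<bar>X \<omega>\<bar> powr b \<le> (2 * K) powr b"
        using le[of \<omega>] a by (intro powr_mono2) auto
      then show ?thesis by (simp add: add_increasing2)
    qed
    ultimately show ?thesis by simp
  qed
  then show "AE \<omega> in M. norm (\<bar>X \<omega>\<bar> powr a) \<le> norm (1 + ((2 * K) powr b + (2 * L) powr b * Y \<omega> powr b))"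
    by (intro AE_I2) (simp add: order_trans[OF _ abs_ge_self])
qed measurable

section \<open>Joint moments of the terms of the two series\<close>

text \<open>Independence of the two sequences splits off \<open>G\<close>, independence within
  \<open>Ms\<close> splits the product, and projecting the common law of the pairs replaces
  \<open>Ms l\<close> by \<open>M\<close>. \<open>G\<close> sees the whole sequence
  \<open>Qs\<close> because it will involve two time indices, possibly equal.\<close>

lemma iid_innovations_nn_integral:
  fixes h :: "nat \<Rightarrow> real \<Rightarrow> ennreal"
  assumes "prob_space P" and iid: "iid_innovations P Ms Qs M Q"
    and [measurable]: "\<And>l. h l \<in> borel_measurable borel"
    and G [measurable]: "G \<in> borel_measurable (\<Pi>\<^sub>M t\<in>{1..}. borel)"
  shows "(\<integral>\<^sup>+\<omega>. (\<Prod>l=1..N. h l (Ms l \<omega>)) * G (\<lambda>t\<in>{1..}. Qs t \<omega>) \<partial>P) =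
    (\<Prod>l=1..N. \<integral>\<^sup>+\<omega>. h l (M \<omega>) \<partial>P) * (\<integral>\<^sup>+\<omega>. G (\<lambda>t\<in>{1..}. Qs t \<omega>) \<partial>P)"
proof -
  interpret prob_space P by fact
  have [measurable]: "M \<in> borel_measurable P" "Q \<in> borel_measurable P"
    and indM: "indep_vars (\<lambda>_. borel) Ms {1..}"
    and indQ: "indep_vars (\<lambda>_. borel) Qs {1..}"
    using iid by (auto simp: iid_innovations_def)
  have Ms: "Ms l \<in> borel_measurable P" and Qs: "Qs l \<in> borel_measurable P" if "l \<ge> 1" for l
    using indM indQ that by (auto simp: indep_vars_def)
  define H where "H x = (\<Prod>l=1..N. h l (x l))" for x :: "nat \<Rightarrow> real"
  have [measurable]: "H \<in> borel_measurable (\<Pi>\<^sub>M t\<in>{1..}. borel)"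
    unfolding H_def
    by (intro borel_measurable_prod_ennreal measurable_compose[OF measurable_component_singleton]) auto
  have HM: "H (\<lambda>t\<in>{1..}. Ms t \<omega>) = (\<Prod>l=1..N. h l (Ms l \<omega>))" for \<omega>
    unfolding H_def by (intro prod.cong) auto
  have "(\<integral>\<^sup>+\<omega>. H (\<lambda>t\<in>{1..}. Ms t \<omega>) * G (\<lambda>t\<in>{1..}. Qs t \<omega>) \<partial>P) =
      (\<integral>\<^sup>+\<omega>. H (\<lambda>t\<in>{1..}. Ms t \<omega>) \<partial>P) * (\<integral>\<^sup>+\<omega>. G (\<lambda>t\<in>{1..}. Qs t \<omega>) \<partial>P)"
    using iid Ms Qs
    by (intro nn_integral_mult_indep[of "\<lambda>\<omega>. \<lambda>t\<in>{1..}. Ms t \<omega>" "\<Pi>\<^sub>M t\<in>{1..}. borel"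
        "\<lambda>\<omega>. \<lambda>t\<in>{1..}. Qs t \<omega>" "\<Pi>\<^sub>M t\<in>{1..}. borel" H G] measurable_restrict)
      (use \<open>H \<in> _\<close> G in \<open>auto simp: iid_innovations_def simp del: One_nat_def\<close>)
  moreover have "(\<integral>\<^sup>+\<omega>. H (\<lambda>t\<in>{1..}. Ms t \<omega>) \<partial>P) = (\<Prod>l=1..N. \<integral>\<^sup>+\<omega>. h l (Ms l \<omega>) \<partial>P)"
    unfolding HM
    by (intro indep_vars_nn_integral indep_vars_compose2[OF indep_vars_subset[OF indM]]) auto
  moreover have "(\<integral>\<^sup>+\<omega>. h l (Ms l \<omega>) \<partial>P) = (\<integral>\<^sup>+\<omega>. h l (M \<omega>) \<partial>P)" if l: "l \<ge> 1" for l
  proof -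
    note [measurable] = Ms[OF l] Qs[OF l]
    have "(\<integral>\<^sup>+\<omega>. h l (Ms l \<omega>) \<partial>P) = (\<integral>\<^sup>+z. h l (fst z) \<partial>distr P (borel \<Otimes>\<^sub>M borel) (\<lambda>\<omega>. (Ms l \<omega>, Qs l \<omega>)))"
      by (subst nn_integral_distr) auto
    also have "\<dots> = (\<integral>\<^sup>+z. h l (fst z) \<partial>distr P (borel \<Otimes>\<^sub>M borel) (\<lambda>\<omega>. (M \<omega>, Q \<omega>)))"
      using iid l by (simp add: iid_innovations_def)
    also have "\<dots> = (\<integral>\<^sup>+\<omega>. h l (M \<omega>) \<partial>P)"
      by (subst nn_integral_distr) auto
    finally show ?thesis .
  qed
  ultimately show ?thesis by (simp add: HM del: One_nat_def)
qed

lemma iid_innovations_nn_integral_Q: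
  assumes iid: "iid_innovations P Ms Qs M Q" and "l \<ge> 1" and "prob_space P"
    and [measurable]: "g \<in> borel_measurable borel"
  shows "(\<integral>\<^sup>+\<omega>. g (Qs l \<omega>) \<partial>P) = (\<integral>\<^sup>+\<omega>. g (Q \<omega>) \<partial>P)"
proof -
  interpret prob_space P by fact
  have [measurable]: "M \<in> borel_measurable P" "Q \<in> borel_measurable P"
      "Ms l \<in> borel_measurable P" "Qs l \<in> borel_measurable P"
    using iid \<open>l \<ge> 1\<close> by (auto simp: iid_innovations_def indep_vars_def)
  have "(\<integral>\<^sup>+\<omega>. g (Qs l \<omega>) \<partial>P) = (\<integral>\<^sup>+z. g (snd z) \<partial>distr P (borel \<Otimes>\<^sub>M borel) (\<lambda>\<omega>. (Ms l \<omega>, Qs l \<omega>)))"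
    by (subst nn_integral_distr) auto
  also have "\<dots> = (\<integral>\<^sup>+z. g (snd z) \<partial>distr P (borel \<Otimes>\<^sub>M borel) (\<lambda>\<omega>. (M \<omega>, Q \<omega>)))"
    using iid \<open>l \<ge> 1\<close> by (simp add: iid_innovations_def)
  also have "\<dots> = (\<integral>\<^sup>+\<omega>. g (Q \<omega>) \<partial>P)"
    by (subst nn_integral_distr) auto
  finally show ?thesis .
qed

lemma abs_prod_powr:
  fixes f :: "'a \<Rightarrow> real"
  shows "\<bar>\<Prod>l\<in>I. f l\<bar> powr s = (\<Prod>l\<in>I. \<bar>f l\<bar> powr s)"
  by (induction I rule: infinite_finite_induct) (simp_all add: abs_mult powr_mult)

text \<open>Factors with the same time index are dependent and have to be kept together; padding the
  shorter product with 1 makes one product over independent times.\<close>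

lemma prod_mult_prod_max:
  fixes f g :: "nat \<Rightarrow> 'a::comm_semiring_1"
  shows "(\<Prod>l=1..n. f l) * (\<Prod>l=1..m. g l) =
    (\<Prod>l=1..max n m. (if l \<le> n then f l else 1) * (if l \<le> m then g l else 1))"
proof -
  have "(\<Prod>l=1..k. f l) = (\<Prod>l=1..max n m. if l \<le> k then f l else 1)" if "k \<le> max n m"
    for k and f :: "nat \<Rightarrow> 'a"
    using that by (intro prod.mono_neutral_cong_left) auto
  from this[of n f] this[of m g] show ?thesis by (simp add: prod.distrib)
qed

text \<open>Used to bound mixed moments of possibly dependent quantities by separate moments of
  doubled order.\<close>

lemma powr_mult_powr_le_add:
  fixes x y :: real
  shows "x powr s * y powr t \<le> x powr (2 * s) + y powr (2 * t)"
proof -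
  have "a * b \<le> a * a + b * b" if "a \<ge> 0" "b \<ge> 0" for a b :: real
  proof -
    have "0 \<le> (a - b)\<^sup>2 + a * b" using that by simp
    then show ?thesis by (simp add: power2_eq_square algebra_simps)
  qed
  then show ?thesis unfolding mult_2 powr_add by simp
qed

text \<open>A time up to \<open>min n m\<close> contributes the mixed moment of the two multipliers,
  and a time between the minimum and the maximum contributes the moment of one of them. Each is at
  most \<open>q\<close>, whence the exponent \<open>max n m\<close>. The factor from
  \<open>Qs\<close> is bounded uniformly in \<open>n\<close> and \<open>m\<close>, even when both
  terms use the same vector.\<close>

lemma perpetuity_terms_moment_le:
  fixes b c :: "real ^ 2"
  assumes "prob_space P" and iid: "iid_innovations P Ms Qs M Q"
    and q: "0 \<le> q" "q \<le> 1"
    and both: "(\<integral>\<^sup>+\<omega>. ennreal (\<bar>b $ i + c $ i * M \<omega>\<bar> powr s * \<bar>b $ j + c $ j * M \<omega>\<bar> powr t) \<partial>P) \<le> ennreal q"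
    and i: "(\<integral>\<^sup>+\<omega>. ennreal (\<bar>b $ i + c $ i * M \<omega>\<bar> powr s) \<partial>P) \<le> ennreal q"
    and j: "(\<integral>\<^sup>+\<omega>. ennreal (\<bar>b $ j + c $ j * M \<omega>\<bar> powr t) \<partial>P) \<le> ennreal q"
    and Qi: "integrable P (\<lambda>\<omega>. \<bar>Q \<omega> $ i\<bar> powr (2 * s))"
    and Qj: "integrable P (\<lambda>\<omega>. \<bar>Q \<omega> $ j\<bar> powr (2 * t))"
  shows "(\<integral>\<^sup>+\<omega>. ennreal (\<bar>(\<Prod>l=1..n. b $ i + c $ i * Ms l \<omega>) * Qs (Suc n) \<omega> $ i\<bar> powr s *
        \<bar>(\<Prod>l=1..m. b $ j + c $ j * Ms l \<omega>) * Qs (Suc m) \<omega> $ j\<bar> powr t) \<partial>P)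
    \<le> ennreal (((\<integral>\<omega>. \<bar>Q \<omega> $ i\<bar> powr (2 * s) \<partial>P) + (\<integral>\<omega>. \<bar>Q \<omega> $ j\<bar> powr (2 * t) \<partial>P)) * q ^ max n m)"
proof -
  interpret prob_space P by fact
  have Qs [measurable]: "Qs (Suc l) \<in> borel_measurable P" for l
    using iid by (auto simp: iid_innovations_def indep_vars_def)
  \<comment> \<open>The joint contribution of time \<open>l\<close>: a term whose product has ended
    before \<open>l\<close> contributes 1.\<close>
  define h where "h l x = ennreal ((if l \<le> n then \<bar>b $ i + c $ i * x\<bar> powr s else 1) *
      (if l \<le> m then \<bar>b $ j + c $ j * x\<bar> powr t else 1))" for l x
  have [measurable]: "h l \<in> borel_measurable borel" for l
    unfolding h_def by measurable
  define G where "G z = ennreal (\<bar>z (Suc n) $ i\<bar> powr s * \<bar>z (Suc m) $ j\<bar> powr t)" for z :: "nat \<Rightarrow> real ^ 2"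
  have nth [measurable]: "(\<lambda>v :: real ^ 2. v $ k) \<in> borel_measurable borel" for k
    by (intro borel_measurable_continuous_onI continuous_intros)
  have [measurable]: "(\<lambda>z :: nat \<Rightarrow> real ^ 2. z (Suc k) $ l) \<in> borel_measurable (\<Pi>\<^sub>M t\<in>{1..}. borel)" for k l
    by (rule measurable_compose[OF measurable_component_singleton[of "Suc k" "{1..}" "\<lambda>_. borel"] nth]) auto
  have [measurable]: "G \<in> borel_measurable (\<Pi>\<^sub>M t\<in>{1..}. borel)"
    unfolding G_def by measurable
  have "ennreal (\<bar>(\<Prod>l=1..n. b $ i + c $ i * Ms l \<omega>) * Qs (Suc n) \<omega> $ i\<bar> powr s *
        \<bar>(\<Prod>l=1..m. b $ j + c $ j * Ms l \<omega>) * Qs (Suc m) \<omega> $ j\<bar> powr t) =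
      (\<Prod>l=1..max n m. h l (Ms l \<omega>)) * G (\<lambda>t\<in>{1..}. Qs t \<omega>)" for \<omega>
  proof -
    have "\<bar>(\<Prod>l=1..n. b $ i + c $ i * Ms l \<omega>) * Qs (Suc n) \<omega> $ i\<bar> powr s *
        \<bar>(\<Prod>l=1..m. b $ j + c $ j * Ms l \<omega>) * Qs (Suc m) \<omega> $ j\<bar> powr t =
      ((\<Prod>l=1..n. \<bar>b $ i + c $ i * Ms l \<omega>\<bar> powr s) * (\<Prod>l=1..m. \<bar>b $ j + c $ j * Ms l \<omega>\<bar> powr t)) *
      (\<bar>Qs (Suc n) \<omega> $ i\<bar> powr s * \<bar>Qs (Suc m) \<omega> $ j\<bar> powr t)"
      by (simp add: abs_mult powr_mult abs_prod_powr[symmetric] mult_ac)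
    also have "ennreal \<dots> = ennreal ((\<Prod>l=1..n. \<bar>b $ i + c $ i * Ms l \<omega>\<bar> powr s) *
        (\<Prod>l=1..m. \<bar>b $ j + c $ j * Ms l \<omega>\<bar> powr t)) * G (\<lambda>t\<in>{1..}. Qs t \<omega>)"
      by (simp add: G_def ennreal_mult prod_nonneg)
    also have "ennreal ((\<Prod>l=1..n. \<bar>b $ i + c $ i * Ms l \<omega>\<bar> powr s) *
        (\<Prod>l=1..m. \<bar>b $ j + c $ j * Ms l \<omega>\<bar> powr t)) = (\<Prod>l=1..max n m. h l (Ms l \<omega>))"
      unfolding prod_mult_prod_max h_def by (subst prod_ennreal) auto
    finally show ?thesis .
  qed
  then have "(\<integral>\<^sup>+\<omega>. ennreal (\<bar>(\<Prod>l=1..n. b $ i + c $ i * Ms l \<omega>) * Qs (Suc n) \<omega> $ i\<bar> powr s *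
        \<bar>(\<Prod>l=1..m. b $ j + c $ j * Ms l \<omega>) * Qs (Suc m) \<omega> $ j\<bar> powr t) \<partial>P) =
      (\<Prod>l=1..max n m. \<integral>\<^sup>+\<omega>. h l (M \<omega>) \<partial>P) * (\<integral>\<^sup>+\<omega>. G (\<lambda>t\<in>{1..}. Qs t \<omega>) \<partial>P)"
    by (simp add: iid_innovations_nn_integral[OF \<open>prob_space P\<close> iid] del: One_nat_def)
  also have "\<dots> \<le> (\<Prod>l=1..max n m. ennreal q) *
      ennreal ((\<integral>\<omega>. \<bar>Q \<omega> $ i\<bar> powr (2 * s) \<partial>P) + (\<integral>\<omega>. \<bar>Q \<omega> $ j\<bar> powr (2 * t) \<partial>P))"
  proof (intro mult_mono prod_mono_ennreal)
    fix l assume "l \<in> {1..max n m}"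
    then show "(\<integral>\<^sup>+\<omega>. h l (M \<omega>) \<partial>P) \<le> ennreal q"
      using both i j by (cases "l \<le> n"; cases "l \<le> m") (auto simp: h_def)
  next
    have "(\<integral>\<^sup>+\<omega>. G (\<lambda>t\<in>{1..}. Qs t \<omega>) \<partial>P) \<le>
        (\<integral>\<^sup>+\<omega>. ennreal (\<bar>Qs (Suc n) \<omega> $ i\<bar> powr (2 * s)) + ennreal (\<bar>Qs (Suc m) \<omega> $ j\<bar> powr (2 * t)) \<partial>P)"
    proof (intro nn_integral_mono)
      fix \<omega>
      have "\<bar>Qs (Suc n) \<omega> $ i\<bar> powr s * \<bar>Qs (Suc m) \<omega> $ j\<bar> powr t \<le>
          \<bar>Qs (Suc n) \<omega> $ i\<bar> powr (2 * s) + \<bar>Qs (Suc m) \<omega> $ j\<bar> powr (2 * t)"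
        by (rule powr_mult_powr_le_add)
      then show "G (\<lambda>t\<in>{1..}. Qs t \<omega>) \<le>
          ennreal (\<bar>Qs (Suc n) \<omega> $ i\<bar> powr (2 * s)) + ennreal (\<bar>Qs (Suc m) \<omega> $ j\<bar> powr (2 * t))"
        by (simp add: G_def ennreal_leI flip: ennreal_plus)
    qed
    also have "\<dots> = (\<integral>\<^sup>+\<omega>. ennreal (\<bar>Q \<omega> $ i\<bar> powr (2 * s)) \<partial>P) + (\<integral>\<^sup>+\<omega>. ennreal (\<bar>Q \<omega> $ j\<bar> powr (2 * t)) \<partial>P)"
      using iid_innovations_nn_integral_Q[OF iid _ \<open>prob_space P\<close>, of "Suc n" "\<lambda>v. ennreal (\<bar>v $ i\<bar> powr (2 * s))"]
        iid_innovations_nn_integral_Q[OF iid _ \<open>prob_space P\<close>, of "Suc m" "\<lambda>v. ennreal (\<bar>v $ j\<bar> powr (2 * t))"]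
      by (subst nn_integral_add) auto
    also have "\<dots> = ennreal ((\<integral>\<omega>. \<bar>Q \<omega> $ i\<bar> powr (2 * s) \<partial>P) + (\<integral>\<omega>. \<bar>Q \<omega> $ j\<bar> powr (2 * t) \<partial>P))"
      by (simp add: nn_integral_eq_integral Qi Qj)
    finally show "(\<integral>\<^sup>+\<omega>. G (\<lambda>t\<in>{1..}. Qs t \<omega>) \<partial>P) \<le> \<dots>" .
  qed auto
  also have "\<dots> = ennreal (((\<integral>\<omega>. \<bar>Q \<omega> $ i\<bar> powr (2 * s) \<partial>P) + (\<integral>\<omega>. \<bar>Q \<omega> $ j\<bar> powr (2 * t) \<partial>P)) * q ^ max n m)"
    using q by (simp add: ennreal_power ennreal_mult mult.commute)
  finally show ?thesis .
qed

section \<open>Comparison and non-degeneracy of the multipliers\<close>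

lemma le_if_ratio_ge_1:
  assumes "ratio x y \<ge> 1" "x \<ge> 0" "y \<ge> 0"
  shows "y \<le> x"
  using assms by (cases "y = 0") (auto simp: ratio_def split: if_splits)

lemma less_if_ratio_gt_1:
  assumes "ratio x y > 1" "y > 0"
  shows "y < x"
  using assms by (auto simp: ratio_def split: if_splits)

text \<open>At exponent 1/2 the power is the square root of the product, whose expectation is below
  1; convexity carries this to slightly larger exponents. Taking \<open>V\<close> constantly 1
  covers the moments of a single \<open>U\<close>.\<close>

lemma (in prob_space) eventually_powr_mult_moment_less_1:
  fixes U V :: "'a \<Rightarrow> real"
  assumes U: "integrable M U" "expectation U = 1" and V: "integrable M V" "expectation V = 1"
    and nn: "\<And>\<omega>. U \<omega> \<ge> 0" "\<And>\<omega>. V \<omega> \<ge> 0" and ne: "\<not> (AE \<omega> in M. U \<omega> = V \<omega>)"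
    and r: "1 / 2 < r" "integrable M (\<lambda>\<omega>. (U \<omega> * V \<omega>) powr r)"
  shows "eventually (\<lambda>p. (\<integral>\<^sup>+\<omega>. ennreal ((U \<omega> * V \<omega>) powr p) \<partial>M) < 1) (at_right (1 / 2))"
proof (rule eventually_powr_moment_less_1[OF _ _ _ _ r])
  have [measurable]: "U \<in> borel_measurable M" "V \<in> borel_measurable M"
    using U V by auto
  show "(\<lambda>\<omega>. U \<omega> * V \<omega>) \<in> borel_measurable M" by measurable
  show "U \<omega> * V \<omega> \<ge> 0" for \<omega> using nn by simp
  then have eq: "(U \<omega> * V \<omega>) powr (1 / 2) = sqrt (U \<omega> * V \<omega>)" for \<omega>
    by (rule powr_half_sqrt)
  show "integrable M (\<lambda>\<omega>. (U \<omega> * V \<omega>) powr (1 / 2))"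
    "expectation (\<lambda>\<omega>. (U \<omega> * V \<omega>) powr (1 / 2)) < 1"
    using expectation_sqrt_mult_less_1[OF U V nn ne] unfolding eq .
qed

text \<open>
  Equality would give \<open>A powr \<beta> < A powr \<alpha>\<close>, which puts \<open>A\<close> almost surely on one side of 1,
  against \<open>E (A powr \<alpha>) = 1\<close>.
\<close>
lemma (in prob_space) not_AE_eq_powr_of_less:
  fixes A B :: "'a \<Rightarrow> real"
  assumes AB: "AE \<omega> in M. 0 < A \<omega> \<and> A \<omega> < B \<omega>" and \<alpha>: "\<alpha> > 0" and \<beta>: "\<beta> > 0"
    and I: "integrable M (\<lambda>\<omega>. A \<omega> powr \<alpha>)" "expectation (\<lambda>\<omega>. A \<omega> powr \<alpha>) = 1"
  shows "\<not> (AE \<omega> in M. B \<omega> powr \<beta> = A \<omega> powr \<alpha>)"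
proof
  assume "AE \<omega> in M. B \<omega> powr \<beta> = A \<omega> powr \<alpha>"
  with AB have *: "AE \<omega> in M. 0 < A \<omega> \<and> A \<omega> powr \<beta> < A \<omega> powr \<alpha>"
  proof eventually_elim
    case (elim \<omega>)
    then have "A \<omega> powr \<beta> < B \<omega> powr \<beta>" using \<beta> by (intro powr_less_mono2) auto
    with elim show ?case by simp
  qed
  have one: "integrable M (\<lambda>_. 1 :: real)" by simp
  have e1: "emeasure M (space M) \<noteq> 0" by (simp add: emeasure_space_1)
  consider "\<beta> < \<alpha>" | "\<alpha> \<le> \<beta>" by linarith
  then show False
  proof cases
    case 1
    have "AE \<omega> in M. 1 < A \<omega> powr \<alpha>"
      using *
    proof eventually_elim
      case (elim \<omega>)
      then have "A \<omega> > 1" using 1 powr_mono'[of \<beta> \<alpha> "A \<omega>"] by force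
      then show ?case using \<alpha> by simp
    qed
    then have "expectation (\<lambda>\<omega>. 1) < expectation (\<lambda>\<omega>. A \<omega> powr \<alpha>)"
      using I one e1 by (intro integral_less_AE_space) auto
    with I show False by (simp add: prob_space)
  next
    case 2
    have "AE \<omega> in M. A \<omega> powr \<alpha> < 1"
      using *
    proof eventually_elim
      case (elim \<omega>)
      then have "A \<omega> < 1" using 2 powr_mono[of \<alpha> \<beta> "A \<omega>"] by force
      then show ?case using \<alpha> elim powr_less_mono2[of \<alpha> "A \<omega>" 1] by simp
    qed
    then have "expectation (\<lambda>\<omega>. A \<omega> powr \<alpha>) < expectation (\<lambda>\<omega>. 1)"
      using I one e1 by (intro integral_less_AE_space) auto
    with I show False by (simp add: prob_space)
  qed
qed

section \<open>Asymptotic independence of the two perpetuities\<close>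

theorem theorem4p1:
  fixes P :: "'a measure"
    and Ms :: "nat \<Rightarrow> 'a \<Rightarrow> real" and Qs :: "nat \<Rightarrow> 'a \<Rightarrow> real ^ 2"
    and M :: "'a \<Rightarrow> real" and Q :: "'a \<Rightarrow> real ^ 2"
    and b c \<alpha> :: "real ^ 2"
  assumes "prob_space P"
    and "iid_innovations P Ms Qs M Q"
    and "\<forall>i. b $ i \<ge> 0 \<and> c $ i \<ge> 0"
    and "AE \<omega> in P. M \<omega> > 0" and "\<forall>i. AE \<omega> in P. Q \<omega> $ i > 0"
    and A1: "\<forall>i. ext_expectation P (\<lambda>\<omega>. ln \<bar>b $ i + c $ i * M \<omega>\<bar>) < 0"
    and A2: "\<forall>i. \<alpha> $ i > 0 \<and>
        integrable P (\<lambda>\<omega>. \<bar>b $ i + c $ i * M \<omega>\<bar> powr (\<alpha> $ i)) \<and>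
        (\<integral>\<omega>. \<bar>b $ i + c $ i * M \<omega>\<bar> powr (\<alpha> $ i) \<partial>P) = 1"
    and A3: "\<forall>i. \<exists>\<epsilon>>0. integrable P (\<lambda>\<omega>. \<bar>M \<omega>\<bar> powr (\<alpha> $ i + \<epsilon>)) \<and>
        integrable P (\<lambda>\<omega>. infnorm (Q \<omega>) powr (\<alpha> $ i + \<epsilon>))"
    and A4: "\<forall>i. nonarithmetic (distr P borel (\<lambda>\<omega>. ln \<bar>b $ i + c $ i * M \<omega>\<bar>))"
    and A5: "\<forall>i. (\<forall>x. \<P>(\<omega> in P. (b $ i + c $ i * M \<omega>) * x + Q \<omega> $ i = x) < 1) \<and>
        \<P>(\<omega> in P. Q \<omega> $ i > 0) > 0"
    and A6: "\<forall>i j. \<alpha> $ i > \<alpha> $ j \<longrightarrow> (\<forall>\<epsilon>>0.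
        ((\<lambda>u. ln u * \<P>(\<omega> in P. \<bar>Q \<omega> $ j\<bar> / \<bar>Q \<omega> $ i\<bar> > u powr \<epsilon>)) \<longlongrightarrow> 0) at_top)"
    and "ratio (c $ 2) (c $ 1) > ratio (b $ 2) (b $ 1)"
    and "ratio (b $ 2) (b $ 1) \<ge> 1"
    and "c $ 1 > 0"
  shows "((\<lambda>u. u * \<P>(\<omega> in P.
            perpetuity b c Ms Qs 2 \<omega> > u powr (1 / \<alpha> $ 2) \<and>
            perpetuity b c Ms Qs 1 \<omega> > u powr (1 / \<alpha> $ 1))) \<longlongrightarrow> 0) at_top"
proof -
  interpret prob_space P by fact
  note iid = \<open>iid_innovations P Ms Qs M Q\<close>
  have [measurable]: "M \<in> borel_measurable P" "Q \<in> borel_measurable P"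
    and indM: "indep_vars (\<lambda>_. borel) Ms {1..}"
    and indQ: "indep_vars (\<lambda>_. borel) Qs {1..}"
    using iid by (auto simp: iid_innovations_def)
  have nth [measurable]: "(\<lambda>v :: real ^ 2. v $ k) \<in> borel_measurable borel" for k
    by (intro borel_measurable_continuous_onI continuous_intros)
  have b: "b $ i \<ge> 0" and c: "c $ i \<ge> 0" for i
    using assms(3) by auto
  have \<alpha>: "\<alpha> $ i > 0" for i using A2 by auto
  define A where "A i \<omega> = \<bar>b $ i + c $ i * M \<omega>\<bar>" for i \<omega>
  have [measurable]: "A i \<in> borel_measurable P" for i
    unfolding A_def by measurable
  define U where "U i \<omega> = A i \<omega> powr (\<alpha> $ i)" for i \<omega>
  have U: "integrable P (U i)" "expectation (U i) = 1" "\<And>\<omega>. U i \<omega> \<ge> 0" for i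
    using A2 by (auto simp: U_def[abs_def] A_def)
  have U_powr: "U i \<omega> powr p = A i \<omega> powr (p * \<alpha> $ i)" for i \<omega> p
    by (simp add: U_def powr_powr mult.commute)

  from choice[OF A3] obtain \<epsilon> where "\<forall>i. \<epsilon> i > 0 \<and>
      integrable P (\<lambda>\<omega>. \<bar>M \<omega>\<bar> powr (\<alpha> $ i + \<epsilon> i)) \<and>
      integrable P (\<lambda>\<omega>. infnorm (Q \<omega>) powr (\<alpha> $ i + \<epsilon> i))" ..
  then have \<epsilon>: "\<epsilon> i > 0"
      "integrable P (\<lambda>\<omega>. \<bar>M \<omega>\<bar> powr (\<alpha> $ i + \<epsilon> i))"
      "integrable P (\<lambda>\<omega>. infnorm (Q \<omega>) powr (\<alpha> $ i + \<epsilon> i))" for i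
    by blast+
  have IA: "integrable P (\<lambda>\<omega>. A i \<omega> powr a)" if a: "0 \<le> a" "a \<le> \<alpha> $ i + \<epsilon> i" for i a
    unfolding A_def
  proof (rule integrable_powr_le[OF _ _ _ \<epsilon>(2) b c a])
    show "\<bar>b $ i + c $ i * M \<omega>\<bar> \<le> b $ i + c $ i * \<bar>M \<omega>\<bar>" for \<omega>
      using abs_triangle_ineq[of "b $ i" "c $ i * M \<omega>"] b[of i] c[of i] by (simp add: abs_mult)
  qed simp_all
  have IQ: "integrable P (\<lambda>\<omega>. \<bar>Q \<omega> $ i\<bar> powr a)" if a: "0 \<le> a" "a \<le> \<alpha> $ i + \<epsilon> i" for i a
  proof (rule integrable_powr_le[OF _ _ _ \<epsilon>(3) _ _ a])
    show "\<bar>Q \<omega> $ i\<bar> \<le> 0 + 1 * infnorm (Q \<omega>)" for \<omega>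
      by (simp add: component_le_infnorm_cart)
  qed (simp_all add: infnorm_pos_le)

  \<comment> \<open>Chosen so that \<open>(1 + 2 * \<eta>) * \<alpha> $ i \<le> \<alpha> $ i +
    \<epsilon> i\<close> for both \<open>i\<close>: all moments of order
    \<open>2 * p * \<alpha> $ i\<close> with \<open>0 \<le> p \<le> 1 / 2 + \<eta>\<close> are then
    covered by (A3).\<close>
  define \<eta> where "\<eta> = min (\<epsilon> 1 / (2 * \<alpha> $ 1)) (\<epsilon> 2 / (2 * \<alpha> $ 2))"
  have \<eta>: "\<eta> > 0" using \<epsilon>(1) \<alpha> by (simp add: \<eta>_def)
  have \<eta>_le: "\<eta> \<le> \<epsilon> i / (2 * \<alpha> $ i)" for i :: 2
    using exhaust_2[of i] by (auto simp: \<eta>_def)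
  have \<eta>\<epsilon>: "2 * (\<eta> * \<alpha> $ i) \<le> \<epsilon> i" for i
    using \<eta>_le[of i] \<alpha>[of i] by (simp add: field_simps)
  have le: "2 * p * \<alpha> $ i \<le> \<alpha> $ i + \<epsilon> i" if "p \<le> 1 / 2 + \<eta>" for p i
  proof -
    have "2 * p * \<alpha> $ i \<le> (1 + 2 * \<eta>) * \<alpha> $ i"
      using that \<alpha>[of i] by (intro mult_right_mono) auto
    with \<eta>\<epsilon>[of i] show ?thesis by (simp add: algebra_simps)
  qed
  have IU: "integrable P (\<lambda>\<omega>. U i \<omega> powr r)" if "0 \<le> r" "r \<le> 1 + 2 * \<eta>" for i r
    unfolding U_powr using that \<alpha>[of i] le[of "r / 2" i] by (intro IA) auto

  have "1 < ratio (c $ 2) (c $ 1)"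
    using \<open>1 \<le> ratio (b $ 2) (b $ 1)\<close> \<open>ratio (b $ 2) (b $ 1) < ratio (c $ 2) (c $ 1)\<close>
    by (rule le_less_trans)
  then have cc: "c $ 1 < c $ 2"
    using \<open>c $ 1 > 0\<close> by (rule less_if_ratio_gt_1)
  have bb: "b $ 1 \<le> b $ 2"
    using \<open>1 \<le> ratio (b $ 2) (b $ 1)\<close> b b by (rule le_if_ratio_ge_1)
  \<comment> \<open>The coefficients \<open>b\<close> give only a weak inequality; strictness comes
    from \<open>c $ 1 < c $ 2\<close> and positivity of \<open>M\<close>.\<close>
  have AB: "AE \<omega> in P. 0 < A 1 \<omega> \<and> A 1 \<omega> < A 2 \<omega>"
    using \<open>AE \<omega> in P. M \<omega> > 0\<close>
  proof (rule AE_mp, intro AE_I2 impI)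
    fix \<omega> assume M: "M \<omega> > 0"
    have "b $ 1 + c $ 1 * M \<omega> < b $ 2 + c $ 2 * M \<omega>"
      using bb mult_strict_right_mono[OF cc M] by (rule add_le_less_mono)
    moreover have "0 < b $ 1 + c $ 1 * M \<omega>"
      using b mult_pos_pos[OF \<open>c $ 1 > 0\<close> M] by (rule add_nonneg_pos)
    ultimately show "0 < A 1 \<omega> \<and> A 1 \<omega> < A 2 \<omega>" by (simp add: A_def)
  qed
  have ne21: "\<not> (AE \<omega> in P. U 2 \<omega> = U 1 \<omega>)"
    using not_AE_eq_powr_of_less[OF AB \<alpha> \<alpha> U(1,2)[of 1, unfolded U_def]] unfolding U_def .
  have ne1: "\<not> (AE \<omega> in P. U i \<omega> = 1)" for i
  proof
    assume "AE \<omega> in P. U i \<omega> = 1"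
    then have AE: "AE \<omega> in P. ln (A i \<omega>) = 0"
    proof eventually_elim
      case (elim \<omega>)
      then have "A i \<omega> \<noteq> 0" by (auto simp: U_def)
      then have "\<alpha> $ i * ln (A i \<omega>) = ln (U i \<omega>)" by (simp add: U_def)
      with elim \<alpha>[of i] show ?case by simp
    qed
    \<comment> \<open>Positive and negative part both integrate to 0, so the extended expectation is
      0, against (A1).\<close>
    have "(\<integral>\<^sup>+\<omega>. ennreal (ln (A i \<omega>)) \<partial>P) = (\<integral>\<^sup>+\<omega>. 0 \<partial>P)"
      using AE by (intro nn_integral_cong_AE) auto
    moreover have "(\<integral>\<^sup>+\<omega>. ennreal (- ln (A i \<omega>)) \<partial>P) = (\<integral>\<^sup>+\<omega>. 0 \<partial>P)"
      using AE by (intro nn_integral_cong_AE) auto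
    ultimately have "ext_expectation P (\<lambda>\<omega>. ln (A i \<omega>)) = 0"
      by (simp add: ext_expectation_def zero_ennreal.rep_eq)
    moreover have "ext_expectation P (\<lambda>\<omega>. ln (A i \<omega>)) < 0"
      using A1 by (simp add: A_def)
    ultimately show False by simp
  qed

  \<comment> \<open>The factor 1 is the second variable of the product lemma.\<close>
  have ev1: "eventually (\<lambda>p. (\<integral>\<^sup>+\<omega>. ennreal ((U i \<omega> * 1) powr p) \<partial>P) < 1) (at_right (1 / 2))" for i
    using U ne1[of i] \<eta> IU[of "1 / 2 + \<eta>" i]
    by (intro eventually_powr_mult_moment_less_1[where r = "1 / 2 + \<eta>"]) (auto simp: prob_space)
  \<comment> \<open>Doubling the exponent of each factor gives order \<open>1 + 2 * \<eta>\<close>,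
    the largest one that \<open>IU\<close> admits.\<close>
  have "integrable P (\<lambda>\<omega>. (U 2 \<omega> * U 1 \<omega>) powr (1 / 2 + \<eta>))"
  proof (rule Bochner_Integration.integrable_bound)
    show "integrable P (\<lambda>\<omega>. U 2 \<omega> powr (2 * (1 / 2 + \<eta>)) + U 1 \<omega> powr (2 * (1 / 2 + \<eta>)))"
      using \<eta> by (intro Bochner_Integration.integrable_add IU) (auto simp: algebra_simps)
    show "(\<lambda>\<omega>. (U 2 \<omega> * U 1 \<omega>) powr (1 / 2 + \<eta>)) \<in> borel_measurable P"
      unfolding U_def by measurable
    show "AE \<omega> in P. norm ((U 2 \<omega> * U 1 \<omega>) powr (1 / 2 + \<eta>)) \<le>
        norm (U 2 \<omega> powr (2 * (1 / 2 + \<eta>)) + U 1 \<omega> powr (2 * (1 / 2 + \<eta>)))"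
    proof (rule AE_I2)
      fix \<omega>
      have "(U 2 \<omega> * U 1 \<omega>) powr (1 / 2 + \<eta>) = U 2 \<omega> powr (1 / 2 + \<eta>) * U 1 \<omega> powr (1 / 2 + \<eta>)"
        using U(3) by (simp add: powr_mult)
      also have "\<dots> \<le> U 2 \<omega> powr (2 * (1 / 2 + \<eta>)) + U 1 \<omega> powr (2 * (1 / 2 + \<eta>))"
        by (rule powr_mult_powr_le_add)
      finally show "norm ((U 2 \<omega> * U 1 \<omega>) powr (1 / 2 + \<eta>)) \<le>
          norm (U 2 \<omega> powr (2 * (1 / 2 + \<eta>)) + U 1 \<omega> powr (2 * (1 / 2 + \<eta>)))"
        by simp
    qed
  qed
  then have ev21: "eventually (\<lambda>p. (\<integral>\<^sup>+\<omega>. ennreal ((U 2 \<omega> * U 1 \<omega>) powr p) \<partial>P) < 1) (at_right (1 / 2))"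
    using U ne21 \<eta> by (intro eventually_powr_mult_moment_less_1) auto
  \<comment> \<open>One \<open>p\<close> has to serve all three moment bounds; its upper limit keeps
    the moments of \<open>Q\<close> of order \<open>2 * p * \<alpha> $ i\<close> finite.\<close>
  have "eventually (\<lambda>p. p \<in> {1 / 2<..<1 / 2 + \<eta>}) (at_right (1 / 2))"
    using \<eta> by (intro eventually_at_right_real) auto
  from eventually_happens[OF eventually_conj[OF this eventually_conj[OF ev21 eventually_conj[OF ev1[of 1] ev1[of 2]]]]]
  obtain p where p: "1 / 2 < p" "p < 1 / 2 + \<eta>"
    and p21: "(\<integral>\<^sup>+\<omega>. ennreal ((U 2 \<omega> * U 1 \<omega>) powr p) \<partial>P) < 1"
    and p1: "(\<integral>\<^sup>+\<omega>. ennreal (U 1 \<omega> powr p) \<partial>P) < 1"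
    and p2: "(\<integral>\<^sup>+\<omega>. ennreal (U 2 \<omega> powr p) \<partial>P) < 1"
    by auto
  \<comment> \<open>A common bound for the three moments. Including 1/2 makes it positive, as the
    geometric ratio must be, and being below 1 it is a real number \<open>q\<close>.\<close>
  define m where "m = max (ennreal (1 / 2)) (max (\<integral>\<^sup>+\<omega>. ennreal ((U 2 \<omega> * U 1 \<omega>) powr p) \<partial>P)
    (max (\<integral>\<^sup>+\<omega>. ennreal (U 1 \<omega> powr p) \<partial>P) (\<integral>\<^sup>+\<omega>. ennreal (U 2 \<omega> powr p) \<partial>P)))"
  have half: "ennreal (1 / 2) < 1" "0 < ennreal (1 / 2)"
    unfolding ennreal_less_one_iff ennreal_less_zero_iff by simp_all
  have m: "m < 1" "0 < m"
    using p21 p1 p2 half unfolding m_def max_less_iff_conj less_max_iff_disj by blast+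
  have m_ge: "(\<integral>\<^sup>+\<omega>. ennreal ((U 2 \<omega> * U 1 \<omega>) powr p) \<partial>P) \<le> m"
    "(\<integral>\<^sup>+\<omega>. ennreal (U 1 \<omega> powr p) \<partial>P) \<le> m" "(\<integral>\<^sup>+\<omega>. ennreal (U 2 \<omega> powr p) \<partial>P) \<le> m"
    unfolding m_def le_max_iff_disj by blast+
  from m(1) obtain q where mq: "m = ennreal q"
    by (cases m) auto
  have q: "0 < q" "q < 1"
    using m unfolding mq ennreal_less_one_iff ennreal_less_zero_iff by blast+
  \<comment> \<open>With these exponents the multiplier moments become moments of \<open>U 2\<close>
    and \<open>U 1\<close> of order \<open>p\<close>, and each threshold
    \<open>u powr (1 / \<alpha> $ i)\<close> contributes the same factor
    \<open>u powr - p\<close>.\<close>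
  define s t where "s = p * \<alpha> $ 2" and "t = p * \<alpha> $ 1"
  have st: "s > 0" "t > 0" unfolding s_def t_def using p(1) \<alpha>[of 1] \<alpha>[of 2] by simp_all

  have A2s: "\<bar>b $ 2 + c $ 2 * M \<omega>\<bar> powr s = U 2 \<omega> powr p" for \<omega>
    by (simp add: U_powr s_def A_def)
  have A1t: "\<bar>b $ 1 + c $ 1 * M \<omega>\<bar> powr t = U 1 \<omega> powr p" for \<omega>
    by (simp add: U_powr t_def A_def)
  have A21: "U 2 \<omega> powr p * U 1 \<omega> powr p = (U 2 \<omega> * U 1 \<omega>) powr p" for \<omega>
    using U(3) by (simp add: powr_mult)

  define K where "K = (\<integral>\<omega>. \<bar>Q \<omega> $ 2\<bar> powr (2 * s) \<partial>P) + (\<integral>\<omega>. \<bar>Q \<omega> $ 1\<bar> powr (2 * t) \<partial>P)"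
  have K: "K \<ge> 0" by (simp add: K_def)
  define x where "x i n \<omega> = (\<Prod>l=1..n. b $ i + c $ i * Ms l \<omega>) * Qs (Suc n) \<omega> $ i" for i n \<omega>
  have mom: "(\<integral>\<^sup>+\<omega>. ennreal (\<bar>x 2 n \<omega>\<bar> powr s * \<bar>x 1 k \<omega>\<bar> powr t) \<partial>P)
      \<le> ennreal (K * sqrt q ^ n * sqrt q ^ k)" for n k
  proof -
    have "(\<integral>\<^sup>+\<omega>. ennreal (\<bar>x 2 n \<omega>\<bar> powr s * \<bar>x 1 k \<omega>\<bar> powr t) \<partial>P) \<le> ennreal (K * q ^ max n k)"
      unfolding x_def K_def
    proof (rule perpetuity_terms_moment_le[OF \<open>prob_space P\<close> iid])
      show "(\<integral>\<^sup>+\<omega>. ennreal (\<bar>b $ 2 + c $ 2 * M \<omega>\<bar> powr s * \<bar>b $ 1 + c $ 1 * M \<omega>\<bar> powr t) \<partial>P) \<le> ennreal q"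
        unfolding A2s A1t A21 mq[symmetric] by (rule m_ge)
      show "(\<integral>\<^sup>+\<omega>. ennreal (\<bar>b $ 2 + c $ 2 * M \<omega>\<bar> powr s) \<partial>P) \<le> ennreal q"
        unfolding A2s mq[symmetric] by (rule m_ge)
      show "(\<integral>\<^sup>+\<omega>. ennreal (\<bar>b $ 1 + c $ 1 * M \<omega>\<bar> powr t) \<partial>P) \<le> ennreal q"
        unfolding A1t mq[symmetric] by (rule m_ge)
      show "integrable P (\<lambda>\<omega>. \<bar>Q \<omega> $ 2\<bar> powr (2 * s))"
        using p st le[of p 2] by (intro IQ) (auto simp: s_def)
      show "integrable P (\<lambda>\<omega>. \<bar>Q \<omega> $ 1\<bar> powr (2 * t))"
        using p st le[of p 1] by (intro IQ) (auto simp: t_def)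
    qed (use q in auto)
    \<comment> \<open>Since \<open>2 * max n k \<ge> n + k\<close>, passing to \<open>sqrt q\<close>
      turns the maximum into a product of separate geometric factors.\<close>
    also have "q ^ max n k = sqrt q ^ (2 * max n k)"
      using q by (simp add: power_mult)
    also have "ennreal (K * sqrt q ^ (2 * max n k)) \<le> ennreal (K * sqrt q ^ (n + k))"
      using q K by (intro ennreal_leI mult_left_mono power_decreasing) auto
    finally show ?thesis by (simp add: power_add mult.assoc)
  qed
  have x_meas: "x i n \<in> borel_measurable P" for i n
  proof -
    have "Ms l \<in> borel_measurable P" if "l \<in> {1..n}" for l
      using indM that by (auto simp: indep_vars_def)
    moreover have [measurable]: "Qs (Suc n) \<in> borel_measurable P"
      using indQ by (auto simp: indep_vars_def)
    ultimately show ?thesis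
      unfolding x_def
      by (intro borel_measurable_times borel_measurable_prod borel_measurable_add) auto
  qed
  have z: "0 < sqrt q" "sqrt q < 1" using q by auto
  obtain C where C: "\<And>v w. v > 0 \<Longrightarrow> w > 0 \<Longrightarrow>
      prob {\<omega> \<in> space P. (\<Sum>n. x 2 n \<omega>) > v \<and> (\<Sum>n. x 1 n \<omega>) > w} \<le> C * v powr - s * w powr - t"
    by (rule prob_two_suminf_gt_le[OF x_meas[of 2] x_meas[of 1] st z K mom]) (rule that)
  let ?E = "\<lambda>u. {\<omega> \<in> space P. perpetuity b c Ms Qs 2 \<omega> > u powr (1 / \<alpha> $ 2) \<and>
      perpetuity b c Ms Qs 1 \<omega> > u powr (1 / \<alpha> $ 1)}"
  have bound: "u * prob (?E u) \<le> C * u powr (1 - 2 * p)" if u: "u > 0" for u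
  proof -
    have "prob (?E u) \<le> C * (u powr (1 / \<alpha> $ 2)) powr - s * (u powr (1 / \<alpha> $ 1)) powr - t"
      using C[of "u powr (1 / \<alpha> $ 2)" "u powr (1 / \<alpha> $ 1)"] u
      by (simp add: perpetuity_def x_def)
    also have "\<dots> = C * (u powr - p * u powr - p)"
      using \<alpha>[of 1] \<alpha>[of 2] by (simp add: powr_powr s_def t_def)
    finally have "u * prob (?E u) \<le> u * (C * (u powr - p * u powr - p))"
      using u by (intro mult_left_mono) auto
    also have "\<dots> = C * u powr (1 - 2 * p)"
    proof -
      have "u * (u powr - p * u powr - p) = u powr (1 + (- p + - p))"
        unfolding powr_add using u by simp
      then show ?thesis by (simp add: algebra_simps)
    qed
    finally show ?thesis .
  qed
  show ?thesis
  proof (rule tendsto_sandwich)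
    show "\<forall>\<^sub>F u in at_top. 0 \<le> u * prob (?E u)"
      using eventually_ge_at_top[of 0] by eventually_elim (intro mult_nonneg_nonneg measure_nonneg)
    show "\<forall>\<^sub>F u in at_top. u * prob (?E u) \<le> C * u powr (1 - 2 * p)"
      using eventually_gt_at_top[of 0] by eventually_elim (rule bound)
    show "((\<lambda>_. 0 :: real) \<longlongrightarrow> 0) at_top" by (rule tendsto_const)
    \<comment> \<open>The exponent is negative exactly because \<open>p > 1 / 2\<close>.\<close>
    have "((\<lambda>u. u powr (1 - 2 * p)) \<longlongrightarrow> 0) at_top"
      using p(1) by (intro tendsto_neg_powr filterlim_ident) simp
    then show "((\<lambda>u. C * u powr (1 - 2 * p)) \<longlongrightarrow> 0) at_top"
      by (rule tendsto_mult_right_zero)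
  qed
qed

end
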